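(* Let $G$ be a connected simple graph with $n$ vertices and $m$ edges, with maximum vertex degree $\Delta(G)$ and minimum vertex degree $\delta(G)$, and let $q_1\ge q_2\ge\dots\ge q_n\ge 0$ be its signless Laplacian eigenvalues. For $1\le k\le n$ put $S^+_k(G)=\sum_{i=1}^k q_i$. If $1\le k\le n-1$, then $$S^+_k(G)\le \frac{2mk}{n}+\frac{\sqrt{k(n-k)\big(8mn+n^2(\Delta(G)-\delta(G))^2\big)}}{2n},$$ with equality if and only if $G\cong K_n$ and $k=1$. Moreover, for $k=n$ the equality $S^+_n(G)=\frac{2mn}{n}+\frac{\sqrt{n\cdot 0\cdot(8mn+n^2(\Delta(G)-\delta(G))^2)}}{2n}$ (i.e. $S^+_n(G)=2m$) always holds.
   Context: The signless Laplacian matrix of $G$ is $Q(G)=D(G)+A(G)$, where $A(G)$ is the adjacency matrix and $D(G)$ the diagonal matrix of vertex degrees; its eigenvalues are real and nonnegative. $K_n$ is the complete graph on $n$ vertices. *)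

theory Defs
  imports
    "HOL-Computational_Algebra.Fundamental_Theorem_Algebra"
    "Jordan_Normal_Form.Char_Poly"
    "Graph_Theory.Graph_Theory"
begin

text \<open>
  A finite simple graph is a \<^const>\<open>graph\<close>: a finite symmetric digraph without loops and
  parallel arcs. Each undirected edge is represented by two opposite arcs, so edges are counted
  as unordered pairs of end points, while the degree of a vertex is its out-degree.
\<close>

definition num_edges :: "('a, 'b) pre_digraph \<Rightarrow> nat" where
  "num_edges G = card {{u, v} | u v. u \<rightarrow>\<^bsub>G\<^esub> v}"

definition max_degree :: "('a, 'b) pre_digraph \<Rightarrow> nat" where
  "max_degree G = Max (out_degree G ` verts G)"

definition min_degree :: "('a, 'b) pre_digraph \<Rightarrow> nat" where
  "min_degree G = Min (out_degree G ` verts G)"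

text \<open>
  Rows and columns of the matrices below are indexed by positions in the list \<open>vs\<close>, which is
  meant to be an enumeration of the vertices of \<open>G\<close> without repetitions.
\<close>

definition adjacency_matrix :: "('a, 'b) pre_digraph \<Rightarrow> 'a list \<Rightarrow> real mat" where
  "adjacency_matrix G vs =
     mat (length vs) (length vs) (\<lambda>(i, j). if vs ! i \<rightarrow>\<^bsub>G\<^esub> vs ! j then 1 else 0)"

definition degree_matrix :: "('a, 'b) pre_digraph \<Rightarrow> 'a list \<Rightarrow> real mat" where
  "degree_matrix G vs = mat_diag (length vs) (\<lambda>i. real (out_degree G (vs ! i)))"

definition signless_laplacian :: "('a, 'b) pre_digraph \<Rightarrow> 'a list \<Rightarrow> real mat" where
  "signless_laplacian G vs = degree_matrix G vs + adjacency_matrix G vs"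

text \<open>
  The signless Laplacian eigenvalues, repeated according to their algebraic multiplicity, in
  decreasing order. As the list is indexed from 0, the \<open>i\<close>-th largest one is at position \<open>i - 1\<close>.
\<close>

definition signless_laplacian_eigenvalues :: "('a, 'b) pre_digraph \<Rightarrow> 'a list \<Rightarrow> real list" where
  "signless_laplacian_eigenvalues G vs =
     rev (sorted_list_of_multiset (proots (char_poly (signless_laplacian G vs))))"

definition S_plus :: "nat \<Rightarrow> ('a, 'b) pre_digraph \<Rightarrow> 'a list \<Rightarrow> real" where
  "S_plus k G vs = (\<Sum>i = 1..k. signless_laplacian_eigenvalues G vs ! (i - 1))"

text \<open>
  Only real roots of the characteristic polynomial are collected above. None are lost: the list
  has one entry for every vertex.
\<close>

lemma size_proots_real_rooted:
  fixes p :: "real poly"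
  assumes "p \<noteq> 0" and "\<And>z. poly (map_poly complex_of_real p) z = 0 \<Longrightarrow> z \<in> \<real>"
  shows "size (proots p) = degree p"
  using assms
proof (induction "degree p" arbitrary: p rule: less_induct)
  case less
  show ?case
  proof (cases "degree p = 0")
    case True
    then show ?thesis by (metis degree_eq_zeroE proots_const size_empty)
  next
    case False
    then have "\<not> constant (poly (map_poly complex_of_real p))"
      by (simp add: constant_degree degree_map_poly)
    then obtain z where z: "poly (map_poly complex_of_real p) z = 0"
      using fundamental_theorem_of_algebra by blast
    with less.prems obtain r where r: "z = of_real r" by (metis Reals_cases)
    have "poly p r = 0" using z r by simp
    then obtain q where q: "p = [:- r, 1:] * q"
      by (metis dvdE poly_eq_0_iff_dvd)
    with less.prems(1) have q0: "q \<noteq> 0" by auto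
    have deg: "degree p = Suc (degree q)"
      unfolding q using q0 by (subst degree_mult_eq) auto
    interpret H: map_poly_inj_idom_hom complex_of_real ..
    have "map_poly complex_of_real p = map_poly complex_of_real [:- r, 1:] * map_poly complex_of_real q"
      unfolding q by (rule H.hom_mult)
    then have "size (proots q) = degree q"
      using less.hyps[of q] less.prems(2) deg q0 by auto
    moreover have "proots p = {#r#} + proots q"
      unfolding q using q0 by (subst proots_mult) (auto simp del: mult_pCons_left)
    ultimately show ?thesis using deg by simp
  qed
qed

lemma signless_laplacian_carrier:
  "signless_laplacian G vs \<in> carrier_mat (length vs) (length vs)"
  by (simp add: signless_laplacian_def degree_matrix_def adjacency_matrix_def mat_diag_def)

lemma signless_laplacian_sym:
  assumes "graph G" "i < length vs" "j < length vs"
  shows "signless_laplacian G vs $$ (i, j) = signless_laplacian G vs $$ (j, i)"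
proof -
  interpret graph G by fact
  have "u \<rightarrow>\<^bsub>G\<^esub> v \<longleftrightarrow> v \<rightarrow>\<^bsub>G\<^esub> u" for u v
    using arcs_ends_symmetric[OF sym_arcs] by blast
  then show ?thesis using assms(2,3)
    by (auto simp: signless_laplacian_def degree_matrix_def adjacency_matrix_def mat_diag_def)
qed

lemma length_signless_laplacian_eigenvalues:
  assumes "graph G"
  shows "length (signless_laplacian_eigenvalues G vs) = length vs"
proof -
  let ?n = "length vs"
  define A where "A = signless_laplacian G vs"
  define B where "B = map_mat complex_of_real A"
  have A: "A \<in> carrier_mat ?n ?n" unfolding A_def by (rule signless_laplacian_carrier)
  then have B: "B \<in> carrier_mat ?n ?n" by (simp add: B_def)
  have sym: "A $$ (i, j) = A $$ (j, i)" if "i < ?n" "j < ?n" for i j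
    unfolding A_def by (rule signless_laplacian_sym[OF assms that])
  have "z \<in> \<real>" if z: "poly (map_poly complex_of_real (char_poly A)) z = 0" for z
  proof -
    have "poly (char_poly B) z = 0"
      using z unfolding B_def of_real_hom.char_poly_hom[OF A] .
    then obtain v where v: "v \<in> carrier_vec ?n" "v \<noteq> 0\<^sub>v ?n" and ev: "B *\<^sub>v v = z \<cdot>\<^sub>v v"
      using eigenvalue_root_char_poly[OF B] B unfolding eigenvalue_def eigenvector_def by auto
    define s where "s = (\<Sum>i<?n. cmod (v $ i) ^ 2)"
    define w where "w = (\<Sum>i<?n. \<Sum>j<?n. cnj (v $ i) * (of_real (A $$ (i, j)) * v $ j))"
    have row: "(\<Sum>j<?n. of_real (A $$ (i, j)) * v $ j) = z * v $ i" if "i < ?n" for i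
    proof -
      have "(B *\<^sub>v v) $ i = z * v $ i" using ev v that by simp
      then show ?thesis using that v A B
        by (simp add: B_def scalar_prod_def atLeast0LessThan)
    qed
    have "w = (\<Sum>i<?n. cnj (v $ i) * (z * v $ i))"
      unfolding w_def by (intro sum.cong refl) (simp add: row flip: sum_distrib_left)
    also have "\<dots> = z * of_real s"
      unfolding s_def of_real_sum sum_distrib_left
      by (intro sum.cong refl) (simp add: complex_norm_square mult_ac del: of_real_power)
    finally have w: "w = z * of_real s" .
    have "cnj w = (\<Sum>i<?n. \<Sum>j<?n. v $ i * (of_real (A $$ (i, j)) * cnj (v $ j)))"
      by (simp add: w_def)
    also have "\<dots> = w"
      unfolding w_def by (subst sum.swap) (intro sum.cong refl, simp add: sym mult_ac)
    finally have "w \<in> \<real>" by (simp add: Reals_cnj_iff)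
    have "\<exists>i<?n. v $ i \<noteq> 0"
      using v by (metis carrier_vecD eq_vecI index_zero_vec)
    then obtain i where i: "i < ?n" "v $ i \<noteq> 0" by blast
    have "0 < cmod (v $ i) ^ 2" using i by simp
    also have "\<dots> \<le> s" unfolding s_def using i by (intro member_le_sum) auto
    finally have "z = w / of_real s" using w by simp
    then show "z \<in> \<real>" using \<open>w \<in> \<real>\<close> by simp
  qed
  moreover have "degree (char_poly A) = ?n" "char_poly A \<noteq> 0"
    using degree_monic_char_poly[OF A] by auto
  ultimately have "size (proots (char_poly A)) = ?n"
    using size_proots_real_rooted by metis
  then show ?thesis
    by (metis A_def length_rev mset_sorted_list_of_multiset signless_laplacian_eigenvalues_def size_mset)
qed

end

theory Submission
  imports Defs "Jordan_Normal_Form.Schur_Decomposition"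
begin

text \<open>
  The traces of \<open>Q\<close> and \<open>Q\<^sup>2\<close> give \<open>\<Sum> q\<^sub>i = 2m\<close> and \<open>\<Sum> q\<^sub>i\<^sup>2 = \<Sum> d\<^sub>i\<^sup>2 + 2m\<close>. The Cauchy-Schwarz
  inequality on the first \<open>k\<close> and on the last \<open>n - k\<close> eigenvalues bounds their partial sum in terms
  of these two numbers, and Popoviciu's inequality bounds the variance of the degrees by
  \<open>(\<Delta> - \<delta>)\<^sup>2 / 4\<close>. In the case of equality \<open>Q\<close> has at most two eigenvalues \<open>a\<close> and \<open>b\<close>, so that
  \<open>(Q - a)(Q - b) = 0\<close>; since \<open>Q\<close> has nonnegative entries, this makes adjacency transitive on distinct
  vertices, and a connected graph with this property is complete. The multiplicities then follow
  from the trace.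
\<close>

section \<open>Traces\<close>

definition mtrace :: "'a :: comm_ring_1 mat \<Rightarrow> 'a" where
  "mtrace A = (\<Sum>i<dim_row A. A $$ (i, i))"

lemma index_mult_mat_sum:
  assumes "A \<in> carrier_mat n m" "B \<in> carrier_mat m l" "i < n" "j < l"
  shows "(A * B) $$ (i, j) = (\<Sum>k<m. A $$ (i, k) * B $$ (k, j))"
  using assms by (simp add: scalar_prod_def atLeast0LessThan)

lemma mtrace_mult:
  assumes "A \<in> carrier_mat n m" "B \<in> carrier_mat m n"
  shows "mtrace (A * B) = (\<Sum>i<n. \<Sum>k<m. A $$ (i, k) * B $$ (k, i))"
proof -
  have "dim_row (A * B) = n" using assms by simp
  then show ?thesis unfolding mtrace_def
    using index_mult_mat_sum[OF assms] by (intro sum.cong) auto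
qed

lemma mtrace_mult_commute:
  assumes "A \<in> carrier_mat n m" "B \<in> carrier_mat m n"
  shows "mtrace (A * B) = mtrace (B * A)"
  unfolding mtrace_mult[OF assms] mtrace_mult[OF assms(2,1)]
  by (subst sum.swap) (simp add: mult.commute)

text \<open>Cyclicity of the trace moves \<open>P\<close> to the back of \<open>P * (B * Q)\<close>,
  where \<open>Q * P = 1\<close> cancels it.\<close>

lemma mtrace_similar:
  assumes "similar_mat_wit A B P Q"
  shows "mtrace A = mtrace B"
proof -
  define n where "n = dim_row A"
  note w = similar_mat_witD[OF n_def assms]
  have BQ: "B * Q \<in> carrier_mat n n" using w(5,7) by (rule mult_carrier_mat)
  have "mtrace A = mtrace (P * (B * Q))" using w(3) assoc_mult_mat[OF w(6,5,7)] by simp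
  also have "\<dots> = mtrace ((B * Q) * P)" by (rule mtrace_mult_commute[OF w(6) BQ])
  also have "(B * Q) * P = B" using w(2,5) assoc_mult_mat[OF w(5,7,6)] by simp
  finally show ?thesis .
qed

text \<open>With the same \<open>P\<close> and \<open>Q\<close> for both factors the inner
  \<open>Q * P\<close> cancels. Keeping the witnesses explicit allows a whole product of matrices to
  be triangularized at once.\<close>

lemma similar_mat_wit_mult:
  assumes "similar_mat_wit A B P Q" "similar_mat_wit C D P Q" "A \<in> carrier_mat n n"
  shows "similar_mat_wit (A * C) (B * D) P Q"
proof -
  have n: "n = dim_row A" using assms by simp
  note w = similar_mat_witD[OF n assms(1)]
  have "dim_row C = n" using similar_mat_witD[OF refl assms(2)] w by (metis carrier_matD(1))
  note v = similar_mat_witD[OF this[symmetric] assms(2)]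
  note assoc = assoc_mult_mat[of _ n n _ n _ n]
  have "A * C = (P * B * Q) * (P * D * Q)" using w(3) v(3) by simp
  also have "\<dots> = P * (B * ((Q * P) * (D * Q)))" using w(4-) v(4-) by (simp add: assoc)
  also have "\<dots> = P * (B * D) * Q" using w(2,4-) v(4-) by (simp add: assoc)
  finally show ?thesis using w v by (intro similar_mat_witI[of _ _ n]) auto
qed

lemma similar_mat_wit_diff_scalar:
  fixes c :: "'a :: comm_ring_1"
  assumes "similar_mat_wit A B P Q" "A \<in> carrier_mat n n"
  shows "similar_mat_wit (A - c \<cdot>\<^sub>m 1\<^sub>m n) (B - c \<cdot>\<^sub>m 1\<^sub>m n) P Q"
proof -
  have n: "n = dim_row A" using assms by simp
  note w = similar_mat_witD[OF n assms(1)]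
  have "P * (B - c \<cdot>\<^sub>m 1\<^sub>m n) * Q = (P * B - P * (c \<cdot>\<^sub>m 1\<^sub>m n)) * Q"
    using w by (subst mult_minus_distrib_mat[of P n n]) auto
  also have "\<dots> = P * B * Q - P * (c \<cdot>\<^sub>m 1\<^sub>m n) * Q"
    using w by (intro minus_mult_distrib_mat) auto
  also have "P * (c \<cdot>\<^sub>m 1\<^sub>m n) * Q = c \<cdot>\<^sub>m 1\<^sub>m n"
    using w(1,4-) by (simp add: mult_smult_distrib[of P n n _ n] mult_smult_assoc_mat[of P n n Q n])
  finally show ?thesis using w by (intro similar_mat_witI[of _ _ n]) auto
qed

lemma upper_triangular_mult:
  assumes "A \<in> carrier_mat n n" "B \<in> carrier_mat n n" "upper_triangular A" "upper_triangular B"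
  shows "upper_triangular (A * B)"
    and "\<And>i. i < n \<Longrightarrow> (A * B) $$ (i, i) = A $$ (i, i) * B $$ (i, i)"
proof -
  have zero: "A $$ (i, k) * B $$ (k, j) = 0" if "i < n" "k < n" "k < i \<or> j < k" for i j k
    using assms that upper_triangularD[of A k i] upper_triangularD[of B j k] by auto
  show "upper_triangular (A * B)"
  proof (rule upper_triangularI)
    fix i j assume "j < i" "i < dim_row (A * B)"
    then have ij: "j < i" "i < n" "j < n" using assms(1) by auto
    have "(A * B) $$ (i, j) = (\<Sum>k<n. A $$ (i, k) * B $$ (k, j))"
      using ij by (intro index_mult_mat_sum[OF assms(1,2)])
    also have "\<dots> = 0" using ij by (intro sum.neutral ballI zero) auto
    finally show "(A * B) $$ (i, j) = 0" .
  qed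
  show "(A * B) $$ (i, i) = A $$ (i, i) * B $$ (i, i)" if i: "i < n" for i
  proof -
    have "(\<Sum>k<n. A $$ (i, k) * B $$ (k, i)) = (\<Sum>k\<in>{i}. A $$ (i, k) * B $$ (k, i))"
      using i zero[of i] by (intro sum.mono_neutral_right) (auto simp: neq_iff)
    then show ?thesis using assms i by (subst index_mult_mat_sum[of _ n n _ n]) auto
  qed
qed

text \<open>Schur decomposition makes \<open>A\<close> similar to an upper triangular matrix with
  diagonal \<open>es\<close>; scalar shifts and products act entrywise on that diagonal. The list
  \<open>cs\<close> lets one lemma yield the traces of \<open>A\<close>, of \<open>A * A\<close> and
  of the square of \<open>(A - a)(A - b)\<close>.\<close>

lemma mtrace_prod_diff_scalar:
  fixes A :: "'a :: conjugatable_ordered_field mat"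
  assumes A: "A \<in> carrier_mat n n" and cp: "char_poly A = (\<Prod>e\<leftarrow>es. [:- e, 1:])"
  shows "mtrace (foldr (\<lambda>c M. (A - c \<cdot>\<^sub>m 1\<^sub>m n) * M) cs (1\<^sub>m n)) = (\<Sum>i<n. \<Prod>c\<leftarrow>cs. es ! i - c)"
proof -
  obtain B P Q where "schur_decomposition A es = (B, P, Q)" by (metis prod_cases3)
  from schur_decomposition[OF A cp this]
  have sim: "similar_mat_wit A B P Q" and tri: "upper_triangular B" and diag: "diag_mat B = es"
    by auto
  note w = similar_mat_witD2[OF A sim]
  define F where "F X = foldr (\<lambda>c M. (X - c \<cdot>\<^sub>m 1\<^sub>m n) * M) cs (1\<^sub>m n)" for X :: "'a mat"
  have "similar_mat_wit (F A) (F B) P Q \<and> F A \<in> carrier_mat n n \<and> F B \<in> carrier_mat n n \<and>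
    upper_triangular (F B) \<and> (\<forall>i<n. F B $$ (i, i) = (\<Prod>c\<leftarrow>cs. es ! i - c))"
    unfolding F_def
  proof (induction cs)
    case Nil
    have "similar_mat_wit (1\<^sub>m n) (1\<^sub>m n) P Q" using w by (intro similar_mat_witI[of _ _ n]) auto
    then show ?case by simp
  next
    case (Cons c cs)
    let ?A = "A - c \<cdot>\<^sub>m 1\<^sub>m n" and ?B = "B - c \<cdot>\<^sub>m 1\<^sub>m n"
    have A': "?A \<in> carrier_mat n n" and B': "?B \<in> carrier_mat n n" by auto
    have "upper_triangular ?B" using tri w(5) by (auto intro!: upper_triangularI dest: upper_triangularD)
    moreover have "?B $$ (i, i) = es ! i - c" if "i < n" for i
      using that w(5) unfolding diag[symmetric] diag_mat_def by simp
    ultimately show ?case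
      using Cons.IH similar_mat_wit_diff_scalar[OF sim A, of c] A' B'
        similar_mat_wit_mult[OF _ _ A'] upper_triangular_mult[OF B']
      by auto
  qed
  then have "mtrace (F A) = (\<Sum>i<n. \<Prod>c\<leftarrow>cs. es ! i - c)"
    by (subst mtrace_similar[of _ "F B" P Q]) (auto simp: mtrace_def)
  then show ?thesis by (simp add: F_def)
qed

lemma mtrace_eigenvalues:
  fixes A :: "'a :: conjugatable_ordered_field mat"
  assumes A: "A \<in> carrier_mat n n" and cp: "char_poly A = (\<Prod>e\<leftarrow>es. [:- e, 1:])"
  shows "mtrace A = (\<Sum>i<n. es ! i)" and "mtrace (A * A) = (\<Sum>i<n. (es ! i)\<^sup>2)"
proof -
  have "A - 0 \<cdot>\<^sub>m 1\<^sub>m n = A" using A by (intro eq_matI) auto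
  then show "mtrace A = (\<Sum>i<n. es ! i)" "mtrace (A * A) = (\<Sum>i<n. (es ! i)\<^sup>2)"
    using mtrace_prod_diff_scalar[OF assms, of "[0]"] mtrace_prod_diff_scalar[OF assms, of "[0, 0]"] A
    by (simp_all add: power2_eq_square)
qed

text \<open>
  The matrix \<open>M = (A - a)(A - b)\<close> is symmetric, and the trace of \<open>M\<^sup>2\<close> is both the sum of the
  squared entries of \<open>M\<close> and the sum of \<open>((e - a)(e - b))\<^sup>2\<close> over the eigenvalues.
\<close>

lemma symmetric_two_eigenvalues_square:
  fixes A :: "real mat"
  assumes A: "A \<in> carrier_mat n n" and cp: "char_poly A = (\<Prod>e\<leftarrow>es. [:- e, 1:])"
    and sym: "\<And>i j. i < n \<Longrightarrow> j < n \<Longrightarrow> A $$ (i, j) = A $$ (j, i)"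
    and ab: "\<And>i. i < n \<Longrightarrow> es ! i = a \<or> es ! i = b"
    and ij: "i < n" "j < n"
  shows "(A * A) $$ (i, j) = (a + b) * A $$ (i, j) - (if i = j then a * b else 0)"
proof -
  let ?A = "A - a \<cdot>\<^sub>m 1\<^sub>m n" and ?B = "A - b \<cdot>\<^sub>m 1\<^sub>m n"
  define M where "M = ?A * ?B"
  have AB: "?A \<in> carrier_mat n n" "?B \<in> carrier_mat n n" by auto
  then have M: "M \<in> carrier_mat n n" unfolding M_def by (rule mult_carrier_mat)
  have entry: "M $$ (i, j) = (\<Sum>k<n. A $$ (i, k) * A $$ (k, j)) - (a + b) * A $$ (i, j)
      + (if i = j then a * b else 0)" if "i < n" "j < n" for i j
  proof -
    have "M $$ (i, j) = (\<Sum>k<n. (A $$ (i, k) - (if i = k then a else 0)) *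
        (A $$ (k, j) - (if k = j then b else 0)))"
      unfolding M_def using A that
      by (subst index_mult_mat_sum[of _ n n _ n]) (auto intro!: sum.cong)
    \<comment> \<open>Each delta becomes a condition on the summation index \<open>k\<close>, so
      that its sum collapses to one term.\<close>
    also have "\<dots> = (\<Sum>k<n. A $$ (i, k) * A $$ (k, j) - (if k = i then a * A $$ (k, j) else 0)
        - (if k = j then b * A $$ (i, k) else 0) + (if k = i then if i = j then a * b else 0 else 0))"
      by (intro sum.cong) (auto simp: algebra_simps)
    finally show ?thesis using that by (simp add: sum.distrib sum_subtractf algebra_simps)
  qed
  have Msym: "M $$ (i, j) = M $$ (j, i)" if "i < n" "j < n" for i j
    using that entry[of i j] entry[of j i] sym by (auto simp: mult.commute intro!: sum.cong)
  have "mtrace (M * M) = 0"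
  proof -
    have "foldr (\<lambda>c M. (A - c \<cdot>\<^sub>m 1\<^sub>m n) * M) [a, b, a, b] (1\<^sub>m n) = M * M"
      unfolding M_def using AB by (simp add: assoc_mult_mat[of _ n n _ n _ n])
    then have "mtrace (M * M) = (\<Sum>i<n. \<Prod>c\<leftarrow>[a, b, a, b]. es ! i - c)"
      using mtrace_prod_diff_scalar[OF A cp, of "[a, b, a, b]"] by metis
    also have "\<dots> = 0" using ab by (intro sum.neutral) auto
    finally show ?thesis .
  qed
  moreover have "mtrace (M * M) = (\<Sum>i<n. \<Sum>j<n. (M $$ (i, j))\<^sup>2)"
    unfolding mtrace_mult[OF M M] using Msym by (intro sum.cong) (auto simp: power2_eq_square)
  ultimately have "\<forall>i<n. (\<Sum>j<n. (M $$ (i, j))\<^sup>2) = 0"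
    by (simp add: sum_nonneg_eq_0_iff sum_nonneg)
  then have "M $$ (i, j) = 0" using ij by (simp add: sum_nonneg_eq_0_iff)
  then show ?thesis using entry[OF ij] index_mult_mat_sum[OF A A ij] by simp
qed

text \<open>In positive degree a root exists because there are as many roots as the degree;
  splitting off its linear factor lowers both numbers by one.\<close>

lemma monic_eq_prod_proots:
  fixes p :: "'a :: idom poly"
  assumes "lead_coeff p = 1" "size (proots p) = degree p"
  shows "p = (\<Prod>e\<in>#proots p. [:- e, 1:])"
  using assms
proof (induction "degree p" arbitrary: p)
  case 0
  then have "p = 1" using monic_degree_0 by metis
  then show ?case by simp
next
  case (Suc d)
  then have "proots p \<noteq> {#}" "p \<noteq> 0" by auto
  then obtain r where "r \<in># proots p" by auto
  then have "poly p r = 0" using \<open>p \<noteq> 0\<close> by simp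
  then obtain q where q: "p = [:- r, 1:] * q" by (metis dvdE poly_eq_0_iff_dvd)
  with \<open>p \<noteq> 0\<close> have q0: "q \<noteq> 0" by auto
  have r: "proots p = add_mset r (proots q)"
    unfolding q using q0 by (subst proots_mult) (auto simp del: mult_pCons_left)
  have "degree p = Suc (degree q)" unfolding q using q0 by (subst degree_mult_eq) auto
  moreover have "lead_coeff q = 1" using Suc.prems(1) unfolding q lead_coeff_mult by simp
  ultimately have "q = (\<Prod>e\<in>#proots q. [:- e, 1:])" using Suc r by auto
  then show ?case by (metis q r image_mset_add_mset prod_mset.add_mset)
qed

section \<open>Two inequalities for finite sums\<close>

text \<open>The variance identity with denominators cleared. It contains Cauchy-Schwarz and its
  equality case, as the left side vanishes exactly when \<open>x\<close> is constant on
  \<open>I\<close>.\<close>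

lemma sum_square_deviation:
  fixes x :: "'a \<Rightarrow> real"
  assumes "finite I" "c = real (card I)" "c > 0"
  shows "c * (\<Sum>i\<in>I. (x i - sum x I / c)\<^sup>2) = c * (\<Sum>i\<in>I. (x i)\<^sup>2) - (sum x I)\<^sup>2"
proof -
  define \<mu> where "\<mu> = sum x I / c"
  have "(\<Sum>i\<in>I. (x i - \<mu>)\<^sup>2) = (\<Sum>i\<in>I. (x i)\<^sup>2 - 2 * \<mu> * x i + \<mu>\<^sup>2)"
    by (intro sum.cong) (auto simp: power2_eq_square algebra_simps)
  also have "\<dots> = (\<Sum>i\<in>I. (x i)\<^sup>2) - 2 * \<mu> * sum x I + c * \<mu>\<^sup>2"
    using assms(2) by (simp add: sum.distrib sum_subtractf sum_distrib_left)
  finally show ?thesis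
    using assms(3) unfolding \<mu>_def by (simp add: power2_eq_square field_simps)
qed

text \<open>The gap between the two sides is exactly \<open>n k (n - k) (V + W)\<close>, where
  \<open>V\<close> and \<open>W\<close> are the squared deviations from the mean within the first
  \<open>k\<close> and the last \<open>n - k\<close> terms. It is nonnegative, and zero only if each
  block is constant.\<close>

lemma partial_sum_deviation:
  fixes x :: "nat \<Rightarrow> real"
  assumes k: "0 < k" "k < n"
  defines "S \<equiv> \<Sum>i<k. x i" and "T \<equiv> \<Sum>i<n. x i" and "R \<equiv> \<Sum>i<n. (x i)\<^sup>2"
  shows "(real n * S - real k * T)\<^sup>2 \<le> real k * (real n - real k) * (real n * R - T\<^sup>2)"
    and "(real n * S - real k * T)\<^sup>2 = real k * (real n - real k) * (real n * R - T\<^sup>2) \<Longrightarrow>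
      \<exists>a b. (\<forall>i<k. x i = a) \<and> (\<forall>i. k \<le> i \<and> i < n \<longrightarrow> x i = b)"
proof -
  define l where "l = real n - real k"
  define U where "U = (\<Sum>i\<in>{k..<n}. x i)"
  define V where "V = (\<Sum>i<k. (x i - S / k)\<^sup>2)"
  define W where "W = (\<Sum>i\<in>{k..<n}. (x i - U / l)\<^sup>2)"
  have l: "l > 0" "l = real (card {k..<n})" using k by (auto simp: l_def of_nat_diff)
  have split: "sum f {..<n} = sum f {..<k} + sum f {k..<n}" for f :: "nat \<Rightarrow> real"
    using k by (metis less_imp_le_nat sum.atLeastLessThan_concat atLeast0LessThan zero_le)
  have V: "real k * V = real k * (\<Sum>i<k. (x i)\<^sup>2) - S\<^sup>2"
    unfolding V_def S_def using k by (intro sum_square_deviation) auto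
  have W: "l * W = l * (\<Sum>i\<in>{k..<n}. (x i)\<^sup>2) - U\<^sup>2"
    unfolding W_def U_def using l by (intro sum_square_deviation) auto
  have T: "T = S + U" and R: "R = (\<Sum>i<k. (x i)\<^sup>2) + (\<Sum>i\<in>{k..<n}. (x i)\<^sup>2)"
    unfolding T_def S_def U_def R_def by (rule split)+
  have n: "real n = real k + l" by (simp add: l_def)
  \<comment> \<open>Since \<open>n S - k T = l S - k U\<close>, the mixed terms in
    \<open>S U\<close> cancel and the two blocks separate.\<close>
  have "real k * l * (real n * R - T\<^sup>2) - (real n * S - real k * T)\<^sup>2
      = real n * (l * (real k * (\<Sum>i<k. (x i)\<^sup>2) - S\<^sup>2)
          + real k * (l * (\<Sum>i\<in>{k..<n}. (x i)\<^sup>2) - U\<^sup>2))"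
    unfolding T R n by (simp add: power2_eq_square algebra_simps)
  then have eq: "real k * l * (real n * R - T\<^sup>2) - (real n * S - real k * T)\<^sup>2
      = real n * (real k * l * (V + W))"
    unfolding V[symmetric] W[symmetric] by (simp add: algebra_simps)
  have nonneg: "V \<ge> 0" "W \<ge> 0" by (auto simp: V_def W_def sum_nonneg)
  then have "0 \<le> real n * (real k * l * (V + W))" using l by simp
  with eq show "(real n * S - real k * T)\<^sup>2 \<le> real k * (real n - real k) * (real n * R - T\<^sup>2)"
    unfolding l_def by simp
  assume "(real n * S - real k * T)\<^sup>2 = real k * (real n - real k) * (real n * R - T\<^sup>2)"
  with eq have "real n * (real k * l * (V + W)) = 0" unfolding l_def by simp
  with k l nonneg have "V = 0" "W = 0" by auto
  then have "(\<forall>i<k. x i = S / k) \<and> (\<forall>i. k \<le> i \<and> i < n \<longrightarrow> x i = U / l)"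
    unfolding V_def W_def by (auto simp: sum_nonneg_eq_0_iff)
  then show "\<exists>a b. (\<forall>i<k. x i = a) \<and> (\<forall>i. k \<le> i \<and> i < n \<longrightarrow> x i = b)" by blast
qed

text \<open>Popoviciu's inequality, obtained by summing the nonnegative products
  \<open>(x i - l) * (u - x i)\<close>.\<close>

lemma sum_squares_bounded_range:
  fixes x :: "'a \<Rightarrow> real"
  assumes "\<And>i. i \<in> I \<Longrightarrow> l \<le> x i" "\<And>i. i \<in> I \<Longrightarrow> x i \<le> u"
  shows "real (card I) * (\<Sum>i\<in>I. (x i)\<^sup>2) - (sum x I)\<^sup>2 \<le> (real (card I))\<^sup>2 * (u - l)\<^sup>2 / 4"
proof -
  let ?c = "real (card I)" and ?D = "sum x I"
  have "0 \<le> (\<Sum>i\<in>I. (x i - l) * (u - x i))" using assms by (intro sum_nonneg) simp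
  also have "\<dots> = (\<Sum>i\<in>I. (u + l) * x i - (x i)\<^sup>2 - l * u)"
    by (intro sum.cong) (auto simp: power2_eq_square algebra_simps)
  also have "\<dots> = (u + l) * ?D - (\<Sum>i\<in>I. (x i)\<^sup>2) - ?c * (l * u)"
    by (simp add: sum_subtractf flip: sum_distrib_left)
  finally have "?c * (\<Sum>i\<in>I. (x i)\<^sup>2) \<le> ?c * ((u + l) * ?D - ?c * (l * u))"
    by (intro mult_left_mono) auto
  \<comment> \<open>Completing the square in \<open>?D\<close> leaves the maximum
    \<open>?c\<^sup>2 * (u - l)\<^sup>2 / 4\<close>.\<close>
  moreover have "?c * ((u + l) * ?D - ?c * (l * u)) - ?D\<^sup>2
      = ?c\<^sup>2 * (u - l)\<^sup>2 / 4 - (?D - ?c * (u + l) / 2)\<^sup>2"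
    by (simp add: power2_eq_square field_simps)
  ultimately show ?thesis using zero_le_power2[of "?D - ?c * (u + l) / 2"] by linarith
qed

section \<open>Signless Laplacian\<close>

locale enumerated_graph = graph G for G :: "('a, 'b) pre_digraph" (structure) +
  fixes vs :: "'a list"
  assumes distinct_vs: "distinct vs" and set_vs: "set vs = verts G"
begin

abbreviation n where "n \<equiv> length vs"
abbreviation L where "L \<equiv> signless_laplacian G vs"
abbreviation qs where "qs \<equiv> signless_laplacian_eigenvalues G vs"

definition deg where "deg i = real (out_degree G (vs ! i))"
definition adj where "adj i j \<longleftrightarrow> vs ! i \<rightarrow> vs ! j"

section \<open>Adjacency, degrees and the number of edges\<close>

lemma card_verts: "card (verts G) = n"
  using distinct_card[OF distinct_vs] set_vs by simp

lemma bij_nth: "bij_betw (nth vs) {..<n} (verts G)"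
  using distinct_vs set_vs by (intro bij_betw_nth) auto

lemma adj_sym: "adj i j \<longleftrightarrow> adj j i"
  unfolding adj_def using arcs_ends_symmetric[OF sym_arcs] by blast

lemma not_adj_self: "\<not> adj i i"
  unfolding adj_def using adj_not_same by blast

text \<open>Degrees count arcs; without parallel arcs, distinct arcs leaving \<open>u\<close> have
  distinct heads.\<close>

lemma out_degree_eq_card: "out_degree G u = card {v. u \<rightarrow> v}"
proof -
  have "inj_on (head G) (out_arcs G u)"
    by (intro inj_onI no_multi_arcs) (auto simp: arc_to_ends_def)
  moreover have "head G ` out_arcs G u = {v. u \<rightarrow> v}"
    by (auto simp: arcs_ends_conv image_iff)
  ultimately show ?thesis unfolding out_degree_def by (metis card_image)
qed

lemma sum_adj:
  assumes "i < n"
  shows "(\<Sum>j<n. if adj i j then 1 else 0) = deg i"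
proof -
  have "(\<Sum>j<n. if adj i j then 1 else 0 :: real)
      = (\<Sum>v\<in>verts G. if vs ! i \<rightarrow> v then 1 else 0)"
    unfolding adj_def by (rule sum.reindex_bij_betw[OF bij_nth])
  also have "\<dots> = real (card {v \<in> verts G. vs ! i \<rightarrow> v})" by (simp add: sum.If_cases Int_def)
  also have "{v \<in> verts G. vs ! i \<rightarrow> v} = {v. vs ! i \<rightarrow> v}" using adj_in_verts by auto
  finally show ?thesis by (simp add: deg_def out_degree_eq_card)
qed

text \<open>Double counting along the map from ordered pairs to unordered edges: symmetry and the
  absence of loops give every fibre \<open>F e\<close> exactly two elements.\<close>

lemma card_arcs_ends: "card (arcs_ends G) = 2 * num_edges G"
proof -
  define E where "E = {{u, v} | u v. u \<rightarrow> v}"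
  define F where "F e = {(u, v). u \<rightarrow> v \<and> {u, v} = e}" for e
  have E_image: "E = (\<lambda>(u, v). {u, v}) ` arcs_ends G" unfolding E_def by auto
  have fin: "finite (arcs_ends G)" by (simp add: arcs_ends_conv)
  have "arcs_ends G = (\<Union>e\<in>E. F e)" unfolding E_def F_def by auto
  also have "card \<dots> = (\<Sum>e\<in>E. card (F e))"
  proof (rule card_UN_disjoint)
    show "finite E" using fin by (simp add: E_image)
    show "\<forall>e\<in>E. finite (F e)" using fin by (auto simp: F_def intro: finite_subset)
    show "\<forall>e\<in>E. \<forall>f\<in>E. e \<noteq> f \<longrightarrow> F e \<inter> F f = {}" by (auto simp: F_def)
  qed
  also have "\<dots> = (\<Sum>e\<in>E. 2)"
  proof (rule sum.cong)
    fix e assume "e \<in> E"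
    then obtain u v where e: "e = {u, v}" and uv: "u \<rightarrow> v" unfolding E_def by blast
    have "v \<rightarrow> u" using uv arcs_ends_symmetric[OF sym_arcs] by blast
    then have "F e = {(u, v), (v, u)}" using uv unfolding F_def e by (auto simp: doubleton_eq_iff)
    moreover have "u \<noteq> v" using uv adj_not_same by blast
    ultimately show "card (F e) = 2" by simp
  qed simp
  finally show ?thesis by (simp add: num_edges_def E_def)
qed

text \<open>The handshake lemma: the neighbourhoods of all vertices together make up the set of
  ordered adjacent pairs.\<close>

lemma sum_deg: "(\<Sum>i<n. deg i) = 2 * real (num_edges G)"
proof -
  have "(\<Sum>i<n. deg i) = (\<Sum>v\<in>verts G. real (out_degree G v))"
    unfolding deg_def by (rule sum.reindex_bij_betw[OF bij_nth])
  also have "\<dots> = real (\<Sum>v\<in>verts G. card {w. v \<rightarrow> w})" by (simp add: out_degree_eq_card)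
  also have "(\<Sum>v\<in>verts G. card {w. v \<rightarrow> w}) = card (Sigma (verts G) (\<lambda>v. {w. v \<rightarrow> w}))"
  proof (rule card_SigmaI[symmetric])
    show "\<forall>v\<in>verts G. finite {w. v \<rightarrow> w}"
      using adj_in_verts by (auto intro: finite_subset[OF _ finite_verts])
  qed simp
  also have "Sigma (verts G) (\<lambda>v. {w. v \<rightarrow> w}) = arcs_ends G" using adj_in_verts by auto
  finally show ?thesis by (simp add: card_arcs_ends)
qed

section \<open>The signless Laplacian, its eigenvalue list and its traces\<close>

lemma index_L:
  assumes "i < n" "j < n"
  shows "L $$ (i, j) = (if i = j then deg i else 0) + (if adj i j then 1 else 0)"
  using assms
  by (simp add: signless_laplacian_def degree_matrix_def adjacency_matrix_def mat_diag_def
      deg_def adj_def)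

lemma L_carrier: "L \<in> carrier_mat n n"
  by (rule signless_laplacian_carrier)

lemma L_sym: "i < n \<Longrightarrow> j < n \<Longrightarrow> L $$ (i, j) = L $$ (j, i)"
  using adj_sym by (auto simp: index_L)

lemma length_qs: "length qs = n"
  by (rule length_signless_laplacian_eigenvalues) unfold_locales

lemma mset_qs: "mset qs = proots (char_poly L)"
  by (simp add: signless_laplacian_eigenvalues_def)

lemma qs_antimono:
  assumes "i \<le> j" "j < n"
  shows "qs ! j \<le> qs ! i"
proof -
  have "sorted (rev qs)" by (simp add: signless_laplacian_eigenvalues_def)
  then show ?thesis using assms length_qs by (simp add: sorted_rev_iff_nth_mono)
qed

text \<open>The list \<open>qs\<close> has \<open>n\<close> entries because all roots are real, so
  the linear factors exhaust the degree.\<close>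

lemma char_poly_L: "char_poly L = (\<Prod>e\<leftarrow>qs. [:- e, 1:])"
proof -
  have "char_poly L = (\<Prod>e\<in>#proots (char_poly L). [:- e, 1:])"
    using degree_monic_char_poly[OF L_carrier] length_qs mset_qs
    by (intro monic_eq_prod_proots) (auto simp flip: size_mset)
  then show ?thesis by (simp flip: mset_qs mset_map prod_mset_prod_list)
qed

lemma sum_qs: "(\<Sum>i<n. qs ! i) = 2 * real (num_edges G)"
proof -
  have "(\<Sum>i<n. qs ! i) = mtrace L"
    using mtrace_eigenvalues(1)[OF L_carrier char_poly_L] by simp
  also have "\<dots> = (\<Sum>i<n. deg i)"
    using L_carrier by (auto simp: mtrace_def index_L not_adj_self intro!: sum.cong)
  finally show ?thesis by (simp add: sum_deg)
qed

lemma sum_qs_squares: "(\<Sum>i<n. (qs ! i)\<^sup>2) = (\<Sum>i<n. (deg i)\<^sup>2) + 2 * real (num_edges G)"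
proof -
  have "(\<Sum>i<n. (qs ! i)\<^sup>2) = mtrace (L * L)"
    using mtrace_eigenvalues(2)[OF L_carrier char_poly_L] by simp
  also have "\<dots> = (\<Sum>i<n. \<Sum>j<n. L $$ (i, j) * L $$ (j, i))"
    by (rule mtrace_mult[OF L_carrier L_carrier])
  \<comment> \<open>By symmetry each product is a squared entry. Without loops the diagonal carries
    only the degree, and the off-diagonal entries 0 and 1 equal their squares.\<close>
  also have "\<dots> = (\<Sum>i<n. \<Sum>j<n. (if j = i then (deg j)\<^sup>2 else 0) + (if adj i j then 1 else 0))"
    using adj_sym not_adj_self by (intro sum.cong) (auto simp: index_L power2_eq_square)
  also have "\<dots> = (\<Sum>i<n. (deg i)\<^sup>2 + deg i)"
    by (intro sum.cong) (auto simp: sum.distrib sum_adj)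
  finally show ?thesis by (simp add: sum.distrib sum_deg)
qed

lemma S_plus_eq: "S_plus k G vs = (\<Sum>i<k. qs ! i)"
  unfolding S_plus_def by (rule sum.reindex_bij_witness[of _ Suc "\<lambda>i. i - 1"]) auto

lemma deg_bounds:
  assumes "i < n"
  shows "real (min_degree G) \<le> deg i" "deg i \<le> real (max_degree G)"
proof -
  have "vs ! i \<in> verts G" using assms set_vs nth_mem by blast
  then show "real (min_degree G) \<le> deg i" "deg i \<le> real (max_degree G)"
    unfolding deg_def min_degree_def max_degree_def by auto
qed

section \<open>Complete graphs and matrices with at most two eigenvalues\<close>

lemma adj_trans_complete:
  assumes "connected G"
    and trans: "\<And>u v w. u \<rightarrow> v \<Longrightarrow> v \<rightarrow> w \<Longrightarrow> u \<noteq> w \<Longrightarrow> u \<rightarrow> w"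
  shows "K\<^bsub>n\<^esub> G"
proof -
  have sc: "strongly_connected G"
    using symmetric_connected_imp_strongly_connected sym_arcs assms(1) by blast
  \<comment> \<open>Along a path, every vertex reached is the start itself or, by transitivity, one
    of its neighbours.\<close>
  have "u = v \<or> u \<rightarrow> v" if "u \<rightarrow>\<^sup>* v" for u v
    using that by (induction rule: reachable_induct) (use trans in blast)+
  then have "arcs_ends G = {(u, v). (u, v) \<in> verts G \<times> verts G \<and> u \<noteq> v}"
    using sc adj_in_verts adj_not_same unfolding strongly_connected_def by blast
  moreover have "graph G" by unfold_locales
  ultimately show ?thesis by (simp add: complete_digraph_def card_verts)
qed

lemma complete_adj:
  assumes "K\<^bsub>n\<^esub> G" "i < n" "j < n"
  shows "adj i j \<longleftrightarrow> i \<noteq> j"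
  using assms set_vs distinct_vs
  by (auto simp: adj_def complete_digraph_def nth_eq_iff_index_eq)

lemma complete_deg:
  assumes "K\<^bsub>n\<^esub> G" "i < n"
  shows "deg i = real n - 1"
proof -
  have "deg i = (\<Sum>j<n. if adj i j then 1 else 0)" using assms by (simp add: sum_adj)
  also have "\<dots> = (\<Sum>j<n. 1 - (if j = i then 1 else 0))"
    using assms by (intro sum.cong) (auto simp: complete_adj)
  finally show ?thesis using assms by (simp add: sum_subtractf)
qed

lemma complete_num_edges:
  assumes "K\<^bsub>n\<^esub> G"
  shows "2 * real (num_edges G) = real n * (real n - 1)"
  using assms by (simp add: complete_deg flip: sum_deg)

text \<open>
  A walk \<open>u - v - w\<close> with \<open>u \<noteq> w\<close> gives \<open>L\<^sup>2\<close> a positive entry at \<open>(u, w)\<close>. If \<open>L\<close> has only the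
  two eigenvalues \<open>a\<close> and \<open>b\<close>, then this entry is \<open>(a + b)\<close> times the entry of \<open>L\<close>.
\<close>

lemma two_eigenvalues_complete:
  assumes "connected G" and ab: "\<And>i. i < n \<Longrightarrow> qs ! i = a \<or> qs ! i = b"
  shows "K\<^bsub>n\<^esub> G"
proof (rule adj_trans_complete[OF assms(1)])
  fix u v w assume uv: "u \<rightarrow> v" and vw: "v \<rightarrow> w" and "u \<noteq> w"
  from uv vw have "u \<in> set vs" "v \<in> set vs" "w \<in> set vs" using adj_in_verts set_vs by auto
  then obtain i l j where ilj: "i < n" "l < n" "j < n" "vs ! i = u" "vs ! l = v" "vs ! j = w"
    by (metis in_set_conv_nth)
  with uv vw have "adj i l" "adj l j" by (auto simp: adj_def)
  moreover have "i \<noteq> j" using \<open>u \<noteq> w\<close> ilj by auto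
  ultimately have pos: "0 < L $$ (i, l) * L $$ (l, j)"
    using ilj by (auto simp: index_L deg_def)
  have "(L * L) $$ (i, j) = (\<Sum>k<n. L $$ (i, k) * L $$ (k, j))"
    using ilj by (intro index_mult_mat_sum[OF L_carrier L_carrier])
  also have "\<dots> > 0"
    using ilj pos by (intro sum_pos2[where i = l]) (auto simp: index_L deg_def)
  finally have "(a + b) * L $$ (i, j) > 0"
    using symmetric_two_eigenvalues_square[OF L_carrier char_poly_L L_sym ab, of i j] ilj \<open>i \<noteq> j\<close>
    by simp
  then have "adj i j" using ilj \<open>i \<noteq> j\<close> by (auto simp: index_L split: if_splits)
  then show "u \<rightarrow> w" using ilj by (simp add: adj_def)
qed

text \<open>For a complete graph \<open>L = J + (n - 2) I\<close> with \<open>J\<close> the all-ones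
  matrix. Comparing off-diagonal and diagonal entries of \<open>L * L = (a + b) L - a b I\<close>
  gives the sum and the product of \<open>a\<close> and \<open>b\<close>; the second conclusion says
  that \<open>n - 2\<close> is one of the two.\<close>

lemma complete_eigenvalue_eqs:
  assumes K: "K\<^bsub>n\<^esub> G" and n: "2 \<le> n" and ab: "\<And>i. i < n \<Longrightarrow> qs ! i = a \<or> qs ! i = b"
  shows "a + b = 3 * real n - 4" and "(real n - 2 - a) * (real n - 2 - b) = 0"
proof -
  have entry: "L $$ (i, j) = 1 + (if i = j then real n - 2 else 0)" if "i < n" "j < n" for i j
    using that K by (auto simp: index_L complete_adj complete_deg)
  have square: "(L * L) $$ (i, j) = real n + 2 * (real n - 2) + (if i = j then (real n - 2)\<^sup>2 else 0)"
    if "i < n" "j < n" for i j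
  proof -
    have "(L * L) $$ (i, j) = (\<Sum>k<n. L $$ (i, k) * L $$ (k, j))"
      using that by (intro index_mult_mat_sum[OF L_carrier L_carrier])
    also have "\<dots> = (\<Sum>k<n. 1 + (if k = i then real n - 2 else 0) + (if k = j then real n - 2 else 0)
        + (if k = i then if i = j then (real n - 2)\<^sup>2 else 0 else 0))"
      using that by (intro sum.cong) (auto simp: entry power2_eq_square algebra_simps)
    finally show ?thesis using that by (simp add: sum.distrib)
  qed
  have eq: "real n + 2 * (real n - 2) + (if i = j then (real n - 2)\<^sup>2 else 0)
      = (a + b) * (1 + (if i = j then real n - 2 else 0)) - (if i = j then a * b else 0)"
    if "i < n" "j < n" for i j
    using symmetric_two_eigenvalues_square[OF L_carrier char_poly_L L_sym ab that]
    by (simp add: square[OF that] entry[OF that])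
  \<comment> \<open>The assumption \<open>2 \<le> n\<close> provides the off-diagonal position
    \<open>(0, 1)\<close>.\<close>
  show sum: "a + b = 3 * real n - 4" using eq[of 0 1] n by fastforce
  have "a * b = (a + b) * (real n - 1) - (3 * real n - 4) - (real n - 2)\<^sup>2"
    using eq[of 0 0] n by fastforce
  moreover have "(real n - 2 - a) * (real n - 2 - b)
      = (real n - 2)\<^sup>2 - (a + b) * (real n - 2) + a * b"
    by (simp add: power2_eq_square algebra_simps)
  ultimately show "(real n - 2 - a) * (real n - 2 - b) = 0"
    unfolding sum by (simp add: algebra_simps)
qed

text \<open>The trace determines the multiplicity of \<open>a\<close>:
  \<open>n (n - 1) = n b + k (a - b)\<close> with \<open>b = n - 2\<close> and
  \<open>a - b = n\<close> leaves only \<open>k = 1\<close>.\<close>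

lemma two_eigenvalues_multiplicity:
  assumes K: "K\<^bsub>n\<^esub> G" and k: "0 < k" "k < n"
    and a: "\<forall>i<k. qs ! i = a" and b: "\<forall>i. k \<le> i \<and> i < n \<longrightarrow> qs ! i = b"
  shows "k = 1"
proof -
  have n: "2 \<le> n" using k by simp
  have ab: "qs ! i = a \<or> qs ! i = b" if "i < n" for i using a b that by (meson not_le)
  note eqs = complete_eigenvalue_eqs[OF K n ab]
  have "b \<le> a" using qs_antimono[of 0 k] a b k by auto
  \<comment> \<open>One of the values is \<open>n - 2\<close>, hence the other is
    \<open>2 n - 2\<close>; the decreasing order decides which is which.\<close>
  with eqs n have vals: "b = real n - 2" "a = 2 * real n - 2" by auto
  have "(\<Sum>i<n. qs ! i) = (\<Sum>i<n. b + (if i < k then a - b else 0))"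
    using a b by (intro sum.cong) auto
  also have "\<dots> = real n * b + real k * (a - b)"
  proof -
    have "{..<n} \<inter> {i. i < k} = {..<k}" using k by auto
    then show ?thesis by (simp add: sum.distrib sum.If_cases)
  qed
  finally have "real n * (real n - 1) = real n * b + real k * (a - b)"
    using complete_num_edges[OF K] by (simp add: sum_qs)
  then have "real n * real k = real n" unfolding vals by (simp add: algebra_simps)
  then show ?thesis using n by auto
qed

text \<open>The all-ones vector is an eigenvector, since every row of \<open>L\<close> sums to twice
  the degree. The matching upper bound comes from the general inequality for
  \<open>k = 1\<close>.\<close>

lemma complete_largest_eigenvalue:
  assumes K: "K\<^bsub>n\<^esub> G" and n: "0 < n"
  shows "2 * (real n - 1) \<le> qs ! 0"
proof -
  let ?v = "vec n (\<lambda>_. 1 :: real)"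
  have "L *\<^sub>v ?v = (2 * (real n - 1)) \<cdot>\<^sub>v ?v"
  proof (rule eq_vecI)
    fix i assume "i < dim_vec ((2 * (real n - 1)) \<cdot>\<^sub>v ?v)"
    then have i: "i < n" by simp
    have "(L *\<^sub>v ?v) $ i = (\<Sum>j<n. L $$ (i, j))"
      using i L_carrier by (auto simp: scalar_prod_def atLeast0LessThan)
    also have "\<dots> = (\<Sum>j<n. (if j = i then deg i else 0) + (if adj i j then 1 else 0))"
      using i by (intro sum.cong) (auto simp: index_L)
    also have "\<dots> = 2 * (real n - 1)" using i K by (simp add: sum.distrib sum_adj complete_deg)
    finally show "(L *\<^sub>v ?v) $ i = ((2 * (real n - 1)) \<cdot>\<^sub>v ?v) $ i" using i by simp
  qed (use L_carrier in auto)
  moreover have "?v \<noteq> 0\<^sub>v n" using n by (metis index_vec index_zero_vec(1) zero_neq_one)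
  ultimately have "eigenvalue L (2 * (real n - 1))"
    unfolding eigenvalue_def eigenvector_def using L_carrier by (intro exI[of _ ?v]) auto
  then have "poly (char_poly L) (2 * (real n - 1)) = 0"
    using eigenvalue_root_char_poly[OF L_carrier] by simp
  moreover have "char_poly L \<noteq> 0" using degree_monic_char_poly[OF L_carrier] by auto
  ultimately have "2 * (real n - 1) \<in> set qs" 
    using set_count_proots by (simp flip: set_mset_mset add: mset_qs)
  then obtain i where "i < n" "qs ! i = 2 * (real n - 1)" by (metis in_set_conv_nth length_qs)
  then show ?thesis using qs_antimono[of 0 i] by simp
qed

section \<open>The upper bound and its equality case\<close>

definition S_plus_bound :: "nat \<Rightarrow> real" where
  "S_plus_bound k = 2 * real (num_edges G) * real k / real n
    + sqrt (real k * (real n - real k)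
        * (8 * real (num_edges G) * real n
          + (real n)\<^sup>2 * (real (max_degree G) - real (min_degree G))\<^sup>2)) / (2 * real n)"

text \<open>Two estimates are chained,
  \<open>(n S - k T)\<^sup>2 \<le> c (n R - T\<^sup>2) \<le> c X\<close>: the block estimate for the
  eigenvalues, then Popoviciu for the degrees. Equality at the end forces equality in the first,
  which makes both blocks of eigenvalues constant.\<close>

lemma S_plus_le_bound:
  assumes k: "0 < k" "k < n"
  shows "S_plus k G vs \<le> S_plus_bound k"
    and "S_plus k G vs = S_plus_bound k \<Longrightarrow>
      \<exists>a b. (\<forall>i<k. qs ! i = a) \<and> (\<forall>i. k \<le> i \<and> i < n \<longrightarrow> qs ! i = b)"
proof -
  define S where "S = S_plus k G vs"
  define T where "T = 2 * real (num_edges G)"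
  define R where "R = (\<Sum>i<n. (qs ! i)\<^sup>2)"
  \<comment> \<open>\<open>X\<close> will bound \<open>n R - T\<^sup>2\<close>. The radicand of the
    bound is \<open>4 c X\<close>, and its factor 4 cancels the 2 in the denominator
    \<open>2 n\<close>.\<close>
  define X where "X = real n * T + (real n)\<^sup>2 * (real (max_degree G) - real (min_degree G))\<^sup>2 / 4"
  define c where "c = real k * (real n - real k)"
  have c: "c \<ge> 0" using k by (simp add: c_def)
  have n: "real n > 0" using k by linarith
  have "real n * (\<Sum>i<n. (deg i)\<^sup>2) - T\<^sup>2
      \<le> (real n)\<^sup>2 * (real (max_degree G) - real (min_degree G))\<^sup>2 / 4"
    using sum_squares_bounded_range[of "{..<n}" "real (min_degree G)" deg "real (max_degree G)"]
    by (simp add: deg_bounds sum_deg T_def)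
  then have "real n * R - T\<^sup>2 \<le> X"
    unfolding R_def sum_qs_squares X_def T_def by (simp add: algebra_simps)
  then have cX: "c * (real n * R - T\<^sup>2) \<le> c * X" using c by (rule mult_left_mono)
  have dev: "(real n * S - real k * T)\<^sup>2 \<le> c * (real n * R - T\<^sup>2)"
    using partial_sum_deviation(1)[OF k, of "nth qs"]
    by (simp add: S_def S_plus_eq sum_qs T_def R_def c_def)
  have X4: "8 * real (num_edges G) * real n
      + (real n)\<^sup>2 * (real (max_degree G) - real (min_degree G))\<^sup>2 = 4 * X"
    by (simp add: X_def T_def)
  have "sqrt (c * (4 * X)) = 2 * sqrt (c * X)" by (simp add: real_sqrt_mult)
  then have "S_plus_bound k = (real k * T + sqrt (c * X)) / real n"
    unfolding S_plus_bound_def X4 c_def[symmetric] T_def[symmetric]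
    by (simp add: add_divide_distrib mult.commute)
  then have bound: "real n * S_plus_bound k = real k * T + sqrt (c * X)" using n by simp
  have "real n * S - real k * T \<le> sqrt (c * X)"
    using dev cX by (intro real_le_rsqrt) simp
  then have "real n * S \<le> real n * S_plus_bound k" using bound by simp
  then show "S_plus k G vs \<le> S_plus_bound k" using n by (simp add: S_def)
  assume "S_plus k G vs = S_plus_bound k"
  then have "real n * S - real k * T = sqrt (c * X)" using bound by (simp add: S_def)
  \<comment> \<open>This ensures that squaring \<open>sqrt (c * X)\<close> returns
    \<open>c * X\<close>.\<close>
  moreover have "c * X \<ge> 0" using dev cX zero_le_power2[of "real n * S - real k * T"] by linarith
  ultimately have "(real n * S - real k * T)\<^sup>2 = c * X" by simp
  then have "(real n * S - real k * T)\<^sup>2 = c * (real n * R - T\<^sup>2)" using dev cX by simp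
  then show "\<exists>a b. (\<forall>i<k. qs ! i = a) \<and> (\<forall>i. k \<le> i \<and> i < n \<longrightarrow> qs ! i = b)"
    using partial_sum_deviation(2)[OF k, of "nth qs"]
    by (simp add: S_def S_plus_eq sum_qs T_def R_def c_def)
qed

text \<open>All degrees agree, so the degree gap vanishes and the radicand becomes the perfect
  square of \<open>2 n (n - 1)\<close>.\<close>

lemma complete_bound:
  assumes K: "K\<^bsub>n\<^esub> G" and n: "2 \<le> n"
  shows "S_plus_bound 1 = 2 * (real n - 1)"
proof -
  have "out_degree G v = n - 1" if "v \<in> verts G" for v
  proof -
    have "v \<in> set vs" using that set_vs by simp
    then obtain i where "i < n" "vs ! i = v" by (auto simp: in_set_conv_nth)
    then show ?thesis using complete_deg[OF K, of i] n by (simp add: deg_def)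
  qed
  moreover have "verts G \<noteq> {}" using n set_vs by auto
  ultimately have deg: "max_degree G = n - 1" "min_degree G = n - 1"
    by (simp_all add: max_degree_def min_degree_def)
  have "8 * real (num_edges G) * real n = 4 * (real n)\<^sup>2 * (real n - 1)"
    using complete_num_edges[OF K] by (simp add: power2_eq_square)
  then have "(real n - 1) * (8 * real (num_edges G) * real n) = (2 * real n * (real n - 1))\<^sup>2"
    by (simp add: power2_eq_square)
  then have "sqrt ((real n - 1) * (8 * real (num_edges G) * real n)) = 2 * real n * (real n - 1)"
    using n by simp
  moreover have "vs \<noteq> []" using n by auto
  ultimately show ?thesis using complete_num_edges[OF K] by (simp add: S_plus_bound_def deg)
qed

text \<open>Equality leaves one eigenvalue on each block, which forces completeness and then
  \<open>k = 1\<close>. Conversely, the largest eigenvalue of a complete graph already reaches the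
  bound.\<close>

lemma S_plus_eq_bound_iff:
  assumes "connected G" and k: "0 < k" "k < n"
  shows "S_plus k G vs = S_plus_bound k \<longleftrightarrow> K\<^bsub>n\<^esub> G \<and> k = 1"
proof
  assume "S_plus k G vs = S_plus_bound k"
  then obtain a b where a: "\<forall>i<k. qs ! i = a" and b: "\<forall>i. k \<le> i \<and> i < n \<longrightarrow> qs ! i = b"
    using S_plus_le_bound(2)[OF k] by blast
  have "K\<^bsub>n\<^esub> G" using two_eigenvalues_complete[OF assms(1)] a b by (meson not_le)
  then show "K\<^bsub>n\<^esub> G \<and> k = 1" using two_eigenvalues_multiplicity[OF _ k a b] by simp
next
  assume K: "K\<^bsub>n\<^esub> G \<and> k = 1"
  then have "S_plus_bound k \<le> S_plus k G vs"
    using complete_bound complete_largest_eigenvalue k by (fastforce simp: S_plus_eq)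
  then show "S_plus k G vs = S_plus_bound k" using S_plus_le_bound(1)[OF k] by simp
qed

end

theorem theorem1:
  fixes G :: "('a, 'b) pre_digraph" and vs :: "'a list"
    and n m \<Delta> \<delta> :: nat and bound :: "nat \<Rightarrow> real"
  assumes "graph G" and "connected G"
    and "distinct vs" and "set vs = verts G"
  defines "n \<equiv> card (verts G)" and "m \<equiv> num_edges G"
    and "\<Delta> \<equiv> max_degree G" and "\<delta> \<equiv> min_degree G"
    and "bound \<equiv> \<lambda>k. 2 * real m * real k / real n
           + sqrt (real k * (real n - real k)
               * (8 * real m * real n + (real n)\<^sup>2 * (real \<Delta> - real \<delta>)\<^sup>2)) / (2 * real n)"
  shows "(\<forall>k. 1 \<le> k \<and> k \<le> n - 1 \<longrightarrow>
             S_plus k G vs \<le> bound k \<and> (S_plus k G vs = bound k \<longleftrightarrow> K\<^bsub>n\<^esub> G \<and> k = 1))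
         \<and> S_plus n G vs = bound n \<and> S_plus n G vs = 2 * real m"
proof -
  interpret graph G by fact
  interpret enumerated_graph G vs using assms(3,4) by unfold_locales
  have n: "n = length vs" using card_verts by (simp add: n_def)
  have bound: "bound = S_plus_bound"
    by (rule ext) (simp add: bound_def S_plus_bound_def n m_def \<Delta>_def \<delta>_def)
  \<comment> \<open>Connectedness includes nonemptiness, so the divisions by \<open>n\<close> are
    genuine.\<close>
  have "verts G \<noteq> {}" using assms(2) by (simp add: connected_conv)
  then have "n > 0" by (simp add: n_def card_gt_0_iff)
  have S: "S_plus n G vs = 2 * real m" by (simp add: S_plus_eq sum_qs n m_def)
  \<comment> \<open>At \<open>k = n\<close> the factor \<open>n - k\<close> annihilates the square
    root.\<close>
  moreover have "bound n = 2 * real m" using \<open>n > 0\<close> by (simp add: bound_def)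
  moreover have "S_plus k G vs \<le> bound k \<and> (S_plus k G vs = bound k \<longleftrightarrow> K\<^bsub>n\<^esub> G \<and> k = 1)"
    if "1 \<le> k \<and> k \<le> n - 1" for k
  proof -
    have k: "0 < k" "k < length vs" using that \<open>n > 0\<close> n by auto
    show ?thesis
      unfolding bound n by (intro conjI S_plus_le_bound(1)[OF k] S_plus_eq_bound_iff[OF assms(2) k])
  qed
  ultimately show ?thesis by simp
qed

end
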